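(* Let $\Omega\subset\mathbb{R}^2$ be a simply-connected bounded Lipschitz domain and let $f:D\to\Omega$ be a univalent (injective holomorphic) bi-Lipschitz homeomorphism, where $D=\{z\in\mathbb{C}: |z|<1\}$, with $$f(z)=\sum_{n=0}^\infty a_nz^n,\qquad a_1\in\mathbb{R}.$$ Let $\lambda_1(\Omega)$ be the first eigenvalue of $$-\Delta u=\lambda u\ \text{in }\Omega,\quad u=0\ \text{on }\gamma_0,\quad \frac{\partial u}{\partial\nu}=0\ \text{on }\gamma_1,$$ and $\lambda_1(D)$ the first eigenvalue of $$-\Delta u=\lambda u\ \text{in }D,\quad u=0\ \text{on }\gamma_0',\quad \frac{\partial u}{\partial\nu}=0\ \text{on }\gamma_1',$$ where $\gamma_i=f(\gamma_i')$, $i=0,1$, and let $\phi_1$ be the first eigenfunction of the problem on $D$ with $\int_D\phi_1^2\,dx=1$. Then $$\lambda_1(D)\ \ge\ \lambda_1(\Omega)\left(2\int_D\phi_1^2\,\mathrm{Re}\,f'(z)\,dx-1\right).$$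
   Context: $\mathbb{R}^2$ is identified with $\mathbb{C}$, and $dx$ is Lebesgue area measure. The map $f$ is extended to a homeomorphism $\overline D\to\overline\Omega$, which gives meaning to $\gamma_i=f(\gamma_i')$. The sets $\gamma_0,\gamma_1$ are disjoint relatively open subsets of $\partial\Omega$ with $\overline{\gamma_0}\cup\overline{\gamma_1}=\partial\Omega$; their closures are allowed to intersect. The eigenvalue problems are understood weakly. Let $V$ be the closure in $H^1(\Omega)$ of $V_0$, the set of functions $v$ on $\Omega$ admitting a smooth extension $\tilde v$ to a neighbourhood of $\overline\Omega$ with $\tilde v|_{\gamma_0}=0$. The problem on $\Omega$ is: $u\in V$, $\int_\Omega u^2\,dx=1$, $\int_\Omega\nabla u\cdot\nabla v\,dx=\lambda\int_\Omega uv\,dx$ for all $v\in V$. The problem on $D$ is the same with $\Omega$ replaced by $D$ and $V$ replaced by $V_D=\{v\circ f: v\in V\}\subset H^1(D)$. The first eigenvalue is the smallest one, i.e. the minimum of $\int|\nabla v|^2/\int v^2$ over nonzero $v$ in the respective space. *)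

theory Defs
  imports "HOL-Complex_Analysis.Complex_Analysis"
begin

text \<open>
  The plane is the type \<^typ>\<open>complex\<close>; gradients of real functions are complex numbers
  \<open>u\<^sub>x + \<i> u\<^sub>y\<close>, and \<open>\<bullet>\<close> on \<^typ>\<open>complex\<close> is the Euclidean inner product of the real plane.
  Functions on a set \<open>S\<close> are total functions of which only the values on \<open>S\<close> matter.
\<close>

subsection \<open>Lipschitz domains and bi-Lipschitz homeomorphisms\<close>

text \<open>
  Near each boundary point, in coordinates centred at \<open>p\<close> and rotated by the unit number \<open>c\<close>,
  the domain is the part of the plane above the graph of a Lipschitz function.
\<close>

definition lipschitz_domain :: "complex set \<Rightarrow> bool" where
  "lipschitz_domain \<Omega> \<longleftrightarrow> open \<Omega> \<and> connected \<Omega> \<and> \<Omega> \<noteq> {} \<and>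
     (\<forall>p\<in>frontier \<Omega>. \<exists>r>0. \<exists>c L. \<exists>\<psi>::real \<Rightarrow> real. cmod c = 1 \<and> L-lipschitz_on UNIV \<psi> \<and>
        \<Omega> \<inter> ball p r = {x \<in> ball p r. Im (cnj c * (x - p)) > \<psi> (Re (cnj c * (x - p)))})"

definition bilipschitz_homeomorphism :: "complex set \<Rightarrow> complex set \<Rightarrow> (complex \<Rightarrow> complex) \<Rightarrow> bool" where
  "bilipschitz_homeomorphism S T f \<longleftrightarrow>
     (\<exists>g K L. homeomorphism S T f g \<and> K-lipschitz_on S f \<and> L-lipschitz_on T g)"

subsection \<open>Smooth functions\<close>

primrec Ck_on :: "nat \<Rightarrow> complex set \<Rightarrow> (complex \<Rightarrow> real) \<Rightarrow> bool" where
  "Ck_on 0 U \<phi> \<longleftrightarrow> continuous_on U \<phi>"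
| "Ck_on (Suc k) U \<phi> \<longleftrightarrow> (\<forall>x\<in>U. \<phi> differentiable (at x)) \<and>
     (\<forall>e\<in>Basis. Ck_on k U (\<lambda>x. frechet_derivative \<phi> (at x) e))"

definition smooth_on :: "complex set \<Rightarrow> (complex \<Rightarrow> real) \<Rightarrow> bool" where
  "smooth_on U \<phi> \<longleftrightarrow> (\<forall>k. Ck_on k U \<phi>)"

definition grad :: "(complex \<Rightarrow> real) \<Rightarrow> complex \<Rightarrow> complex" where
  "grad \<phi> x = (\<Sum>e\<in>Basis. frechet_derivative \<phi> (at x) e *\<^sub>R e)"

definition test_function :: "complex set \<Rightarrow> (complex \<Rightarrow> real) \<Rightarrow> bool" where
  "test_function S \<phi> \<longleftrightarrow> smooth_on UNIV \<phi> \<and>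
     compact (closure {x. \<phi> x \<noteq> 0}) \<and> closure {x. \<phi> x \<noteq> 0} \<subseteq> S"

subsection \<open>The Sobolev space \<open>H\<^sup>1\<close>\<close>

definition L2_on :: "complex set \<Rightarrow> (complex \<Rightarrow> 'b::real_normed_vector) \<Rightarrow> bool" where
  "L2_on S u \<longleftrightarrow> u \<in> borel_measurable (lebesgue_on S) \<and>
     integrable (lebesgue_on S) (\<lambda>x. (norm (u x))\<^sup>2)"

text \<open>
  \<open>u\<close> belongs to \<open>H\<^sup>1(S)\<close> with weak gradient \<open>g\<close>; such a \<open>g\<close> is unique up to null sets, which is
  why the integrals below do not depend on its choice.
\<close>

definition has_weak_gradient ::
    "complex set \<Rightarrow> (complex \<Rightarrow> real) \<Rightarrow> (complex \<Rightarrow> complex) \<Rightarrow> bool" where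
  "has_weak_gradient S u g \<longleftrightarrow> L2_on S u \<and> L2_on S g \<and>
     (\<forall>\<phi>. test_function S \<phi> \<longrightarrow>
        (LINT x|lebesgue_on S. u x *\<^sub>R grad \<phi> x) = - (LINT x|lebesgue_on S. \<phi> x *\<^sub>R g x))"

definition H1 :: "complex set \<Rightarrow> (complex \<Rightarrow> real) set" where
  "H1 S = {u. \<exists>g. has_weak_gradient S u g}"

definition H1_closure :: "complex set \<Rightarrow> (complex \<Rightarrow> real) set \<Rightarrow> (complex \<Rightarrow> real) set" where
  "H1_closure S W = {u \<in> H1 S. \<forall>\<epsilon>>0. \<exists>w\<in>W. \<exists>g. has_weak_gradient S (\<lambda>x. u x - w x) g \<and>
     sqrt ((LINT x|lebesgue_on S. (u x - w x)\<^sup>2) + (LINT x|lebesgue_on S. (norm (g x))\<^sup>2)) < \<epsilon>}"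

subsection \<open>Mixed boundary conditions\<close>

definition V_smooth :: "complex set \<Rightarrow> complex set \<Rightarrow> (complex \<Rightarrow> real) set" where
  "V_smooth \<Omega> \<gamma>\<^sub>0 = {v. \<exists>U v'. open U \<and> closure \<Omega> \<subseteq> U \<and> smooth_on U v' \<and>
     (\<forall>x\<in>\<Omega>. v x = v' x) \<and> (\<forall>x\<in>\<gamma>\<^sub>0. v' x = 0)}"

definition V_space :: "complex set \<Rightarrow> complex set \<Rightarrow> (complex \<Rightarrow> real) set" where
  "V_space \<Omega> \<gamma>\<^sub>0 = H1_closure \<Omega> (V_smooth \<Omega> \<gamma>\<^sub>0)"

definition pullback ::
    "complex set \<Rightarrow> (complex \<Rightarrow> complex) \<Rightarrow> (complex \<Rightarrow> real) set \<Rightarrow> (complex \<Rightarrow> real) set" where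
  "pullback S f W = {w. \<exists>v\<in>W. \<forall>z\<in>S. w z = v (f z)}"

subsection \<open>Weak eigenfunctions and the first eigenvalue\<close>

definition weak_eigenfunction ::
    "complex set \<Rightarrow> (complex \<Rightarrow> real) set \<Rightarrow> real \<Rightarrow> (complex \<Rightarrow> real) \<Rightarrow> bool" where
  "weak_eigenfunction S W l u \<longleftrightarrow> u \<in> W \<and> u \<in> H1 S \<and> (LINT x|lebesgue_on S. (u x)\<^sup>2) = 1 \<and>
     (\<forall>g v h. has_weak_gradient S u g \<and> v \<in> W \<and> has_weak_gradient S v h \<longrightarrow>
        (LINT x|lebesgue_on S. g x \<bullet> h x) = l * (LINT x|lebesgue_on S. u x * v x))"

definition rayleigh_quotients :: "complex set \<Rightarrow> (complex \<Rightarrow> real) set \<Rightarrow> real set" where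
  "rayleigh_quotients S W =
     {(LINT x|lebesgue_on S. (norm (g x))\<^sup>2) / (LINT x|lebesgue_on S. (v x)\<^sup>2) | v g.
        v \<in> W \<and> has_weak_gradient S v g \<and> (LINT x|lebesgue_on S. (v x)\<^sup>2) \<noteq> 0}"

text \<open>
  The first eigenvalue is the minimum of the Rayleigh quotients. Writing it as an infimum gives
  a total function that needs no existence hypothesis; the lemmas below show that it is the
  minimum, and the smallest weak eigenvalue, as soon as it is attained by an eigenfunction.
\<close>

definition first_eigenvalue :: "complex set \<Rightarrow> (complex \<Rightarrow> real) set \<Rightarrow> real" where
  "first_eigenvalue S W = Inf (rayleigh_quotients S W)"

lemma rayleigh_quotients_nonneg: "q \<in> rayleigh_quotients S W \<Longrightarrow> 0 \<le> q"
  unfolding rayleigh_quotients_def by auto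

lemma first_eigenvalue_le: "q \<in> rayleigh_quotients S W \<Longrightarrow> first_eigenvalue S W \<le> q"
  unfolding first_eigenvalue_def
  by (rule cInf_lower) (auto intro!: bdd_belowI[where m = 0] rayleigh_quotients_nonneg)

lemma first_eigenvalue_eq_minimum:
  assumes "l \<in> rayleigh_quotients S W" "\<And>q. q \<in> rayleigh_quotients S W \<Longrightarrow> l \<le> q"
  shows "first_eigenvalue S W = l"
  unfolding first_eigenvalue_def using assms by (rule cInf_eq_minimum)

lemma weak_eigenvalue_in_rayleigh_quotients:
  assumes "weak_eigenfunction S W l u"
  shows "l \<in> rayleigh_quotients S W"
proof -
  obtain g where g: "has_weak_gradient S u g"
    using assms by (auto simp: weak_eigenfunction_def H1_def)
  have u: "u \<in> W" "(LINT x|lebesgue_on S. (u x)\<^sup>2) = 1"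
    using assms by (auto simp: weak_eigenfunction_def)
  have "(LINT x|lebesgue_on S. g x \<bullet> g x) = l * (LINT x|lebesgue_on S. u x * u x)"
    using assms g u(1) unfolding weak_eigenfunction_def by blast
  then have "(LINT x|lebesgue_on S. (norm (g x))\<^sup>2) = l"
    using u(2) by (simp add: power2_norm_eq_inner flip: power2_eq_square)
  then show ?thesis
    unfolding rayleigh_quotients_def using g u by (intro CollectI exI[of _ u] exI[of _ g]) auto
qed

lemma first_eigenvalue_least_eigenvalue:
  assumes "weak_eigenfunction S W (first_eigenvalue S W) u"
  shows "first_eigenvalue S W = (LEAST l. \<exists>u. weak_eigenfunction S W l u)"
  using assms
  by (intro Least_equality[symmetric])
     (auto intro: first_eigenvalue_le weak_eigenvalue_in_rayleigh_quotients)

end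

theory Submission
  imports Defs
begin

text \<open>
  Write the eigenfunction on the disc as \<open>\<phi>\<^sub>1 = v \<circ> f\<close> with \<open>v\<close> in the form domain of \<open>\<Omega>\<close>. In two
  dimensions the Dirichlet integral is a conformal invariant, so
  \<open>\<integral>\<^sub>\<Omega> |\<nabla>v|\<^sup>2 = \<integral>\<^sub>D |\<nabla>\<phi>\<^sub>1|\<^sup>2 = \<lambda>\<^sub>1(D)\<close>, while the \<open>L\<^sup>2\<close> norm picks up the Jacobian:
  \<open>\<integral>\<^sub>\<Omega> v\<^sup>2 = \<integral>\<^sub>D \<phi>\<^sub>1\<^sup>2 |f'|\<^sup>2\<close>. Taking \<open>v\<close> as a trial function on \<open>\<Omega>\<close> gives
  \<open>\<lambda>\<^sub>1(\<Omega>) \<integral>\<^sub>D \<phi>\<^sub>1\<^sup>2 |f'|\<^sup>2 \<le> \<lambda>\<^sub>1(D)\<close>, and \<open>|f' - 1|\<^sup>2 \<ge> 0\<close>, that is \<open>|f'|\<^sup>2 \<ge> 2 Re f' - 1\<close>,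
  together with \<open>\<integral>\<^sub>D \<phi>\<^sub>1\<^sup>2 = 1\<close> bounds the remaining integral from below by
  \<open>2 \<integral>\<^sub>D \<phi>\<^sub>1\<^sup>2 Re f' - 1\<close>.

  The work lies in conformal invariance for weak gradients,
  \<open>weak_gradient_conformal_pullback\<close>. It rests on the change of variables formula for
  univalent maps of the plane (\<open>holomorphic_change_of_variables\<close>) and on a way of transporting
  test functions. If \<open>g\<close> is the inverse of \<open>f\<close> and \<open>\<psi>\<close> a test function on \<open>S\<close>, the function to
  test with on \<open>f ` S\<close> is the complex one \<open>g' \<cdot> (\<psi> \<circ> g)\<close>, through its real and imaginary parts
  \<open>A\<close> and \<open>B\<close>: by the Cauchy-Riemann equations the second derivatives of \<open>g\<close> cancel in
  \<open>\<nabla>A + \<i> \<nabla>B = |g'|\<^sup>2 (\<nabla>\<psi>) \<circ> g\<close>, so that the Jacobian needed for the change of variables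
  appears by itself.
\<close>

section \<open>Change of variables for univalent functions\<close>

text \<open>
  A Borel map that preserves Lebesgue measure on Borel sets pulls null sets back to null sets;
  that is what lets both measurability and the image measure pass to the completion.
\<close>

lemma lebesgue_distr_of_lborel_distr:
  fixes T :: "'a::euclidean_space \<Rightarrow> 'b::euclidean_space"
  assumes T[measurable]: "T \<in> borel_measurable borel" and eq: "distr lborel borel T = lborel"
  shows "T \<in> lebesgue \<rightarrow>\<^sub>M lebesgue" and "distr lebesgue lebesgue T = lebesgue"
proof -
  have d: "distr lebesgue lborel T = lborel"
    using eq by (simp add: distr_completion cong: distr_cong)
  show "T \<in> lebesgue \<rightarrow>\<^sub>M lebesgue"
    by (simp add: completion.measurable_completion2 d measurable_completion)
  have "completion (distr lebesgue lborel T) = distr lebesgue lebesgue T"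
    by (rule completion.completion_distr_eq) (simp_all add: d measurable_completion)
  then show "distr lebesgue lebesgue T = lebesgue"
    by (simp add: d)
qed

text \<open>
  Jacobian determinants and the change of variables theorem live on \<^typ>\<open>real^'n\<close>; this map and
  its inverse carry them over to \<^typ>\<open>complex\<close>.
\<close>

definition vec_of_complex :: "complex \<Rightarrow> real^2" where
  "vec_of_complex z = vector [Re z, Im z]"

definition complex_of_vec :: "real^2 \<Rightarrow> complex" where
  "complex_of_vec x = Complex (x $ 1) (x $ 2)"

lemma complex_of_vec_of_complex [simp]: "complex_of_vec (vec_of_complex z) = z"
  by (simp add: complex_of_vec_def vec_of_complex_def)

lemma vec_of_complex_of_vec [simp]: "vec_of_complex (complex_of_vec x) = x"
  by (simp add: complex_of_vec_def vec_of_complex_def vec_eq_iff forall_2)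

lemma bounded_linear_vec_of_complex: "bounded_linear vec_of_complex"
  by (rule linear_conv_bounded_linear[THEN iffD1], rule linearI)
     (simp_all add: vec_of_complex_def vec_eq_iff forall_2)

lemma bounded_linear_complex_of_vec: "bounded_linear complex_of_vec"
  by (rule linear_conv_bounded_linear[THEN iffD1], rule linearI)
     (simp_all add: complex_of_vec_def complex_eq_iff)

lemma lborel_distr_vec_of_complex: "distr lborel borel vec_of_complex = lborel"
proof (rule lborel_eqI[symmetric])
  have meas: "vec_of_complex \<in> borel_measurable borel"
    using bounded_linear_vec_of_complex
    by (intro borel_measurable_continuous_onI) (simp add: linear_continuous_on)
  have basis: "(Basis :: (real^2) set) = {axis 1 1, axis 2 1}"
    by (auto simp: Basis_vec_def UNIV_2)
  have ne: "axis 1 1 \<noteq> (axis 2 1 :: real^2)"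
    by (simp add: axis_eq_axis)
  fix l u :: "real^2"
  assume le: "\<And>b. b \<in> Basis \<Longrightarrow> l \<bullet> b \<le> u \<bullet> b"
  have "vec_of_complex -` box l u = box (complex_of_vec l) (complex_of_vec u)"
    by (auto simp: box_def basis Basis_complex_def inner_axis vec_of_complex_def complex_of_vec_def)
  moreover have "emeasure lborel (box (complex_of_vec l) (complex_of_vec u)) =
      (\<Prod>b\<in>Basis. (u - l) \<bullet> b)"
    using le[of "axis 1 1"] le[of "axis 2 1"] ne by (subst emeasure_lborel_box)
      (auto simp: basis Basis_complex_def inner_axis complex_of_vec_def)
  ultimately show "emeasure (distr lborel borel vec_of_complex) (box l u) =
      (\<Prod>b\<in>Basis. (u - l) \<bullet> b)"
    by (simp add: emeasure_distr meas)
qed simp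

text \<open>
  Compose the measure-preserving map \<^term>\<open>vec_of_complex\<close> with its inverse.
\<close>

lemma lborel_distr_complex_of_vec: "distr lborel borel complex_of_vec = lborel"
proof -
  have meas: "vec_of_complex \<in> borel_measurable borel" "complex_of_vec \<in> borel_measurable borel"
    using bounded_linear_vec_of_complex bounded_linear_complex_of_vec
    by (intro borel_measurable_continuous_onI; simp add: linear_continuous_on)+
  have "distr lborel borel complex_of_vec =
      distr (distr lborel borel vec_of_complex) borel complex_of_vec"
    by (simp add: lborel_distr_vec_of_complex)
  also have "\<dots> = distr lborel borel (complex_of_vec \<circ> vec_of_complex)"
    using meas by (subst distr_distr) auto
  also have "complex_of_vec \<circ> vec_of_complex = id"
    by auto
  also have "distr lborel borel id = (lborel :: complex measure)"
    using distr_id[of lborel] by (simp add: id_def cong: distr_cong)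
  finally show ?thesis .
qed

lemma has_bochner_integral_lebesgue_vec:
  fixes H :: "complex \<Rightarrow> 'b::euclidean_space"
  shows "has_bochner_integral lebesgue H c \<longleftrightarrow>
    has_bochner_integral lebesgue (\<lambda>x. H (complex_of_vec x)) c"
proof -
  have bm: "vec_of_complex \<in> borel_measurable borel" "complex_of_vec \<in> borel_measurable borel"
    using bounded_linear_vec_of_complex bounded_linear_complex_of_vec
    by (intro borel_measurable_continuous_onI; simp add: linear_continuous_on)+
  note V = lebesgue_distr_of_lborel_distr[OF bm(1) lborel_distr_vec_of_complex]
  note C = lebesgue_distr_of_lborel_distr[OF bm(2) lborel_distr_complex_of_vec]
  have m: "H \<in> borel_measurable lebesgue \<longleftrightarrow> (\<lambda>x. H (complex_of_vec x)) \<in> borel_measurable lebesgue"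
  proof
    assume "(\<lambda>x. H (complex_of_vec x)) \<in> borel_measurable lebesgue"
    from measurable_compose[OF V(1) this] show "H \<in> borel_measurable lebesgue" by simp
  qed (use measurable_compose[OF C(1)] in blast)
  have "has_bochner_integral (distr lebesgue lebesgue complex_of_vec) H c \<longleftrightarrow>
      has_bochner_integral lebesgue (\<lambda>x. H (complex_of_vec x)) c" 
    if "H \<in> borel_measurable lebesgue"
    using that C(1) by (simp add: has_bochner_integral_iff integrable_distr_eq integral_distr)
  then show ?thesis
    using m C(2) by (metis has_bochner_integral_iff borel_measurable_integrable)
qed

lemma has_bochner_integral_lebesgue_on_vec:
  assumes "A \<in> sets lebesgue" "vec_of_complex ` A \<in> sets lebesgue"
  shows "has_bochner_integral (lebesgue_on (vec_of_complex ` A))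
      (\<lambda>x. vec_of_complex (H (complex_of_vec x))) (vec_of_complex c) \<longleftrightarrow>
    has_bochner_integral (lebesgue_on A) H c"
proof -
  have ind: "indicator (vec_of_complex ` A) x = (indicator A (complex_of_vec x) :: real)" for x
    by (force simp: indicator_def image_iff intro: bexI[of _ "complex_of_vec x"])
  have lin: "has_bochner_integral M (\<lambda>x. vec_of_complex (K x)) (vec_of_complex c) \<longleftrightarrow>
      has_bochner_integral M K c" for M and K :: "real^2 \<Rightarrow> complex"
    using has_bochner_integral_bounded_linear[OF bounded_linear_vec_of_complex, of M K c]
      has_bochner_integral_bounded_linear[OF bounded_linear_complex_of_vec,
        of M "\<lambda>x. vec_of_complex (K x)" "vec_of_complex c"]
    by auto
  have "has_bochner_integral (lebesgue_on (vec_of_complex ` A))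
      (\<lambda>x. vec_of_complex (H (complex_of_vec x))) (vec_of_complex c) \<longleftrightarrow>
    has_bochner_integral lebesgue
      (\<lambda>x. vec_of_complex (indicator A (complex_of_vec x) *\<^sub>R H (complex_of_vec x))) (vec_of_complex c)"
    using assms by (simp add: has_bochner_integral_restrict_space ind
      linear_cmul[OF bounded_linear.linear[OF bounded_linear_vec_of_complex]])
  also have "\<dots> \<longleftrightarrow> has_bochner_integral lebesgue (\<lambda>z. indicator A z *\<^sub>R H z) c"
    unfolding lin by (rule has_bochner_integral_lebesgue_vec[symmetric])
  finally show ?thesis
    using assms by (simp add: has_bochner_integral_restrict_space)
qed

lemma absolutely_integrable_iff_has_bochner_integral:
  fixes H :: "'a::euclidean_space \<Rightarrow> 'b::euclidean_space"
  assumes "A \<in> sets lebesgue"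
  shows "H absolutely_integrable_on A \<and> integral A H = c \<longleftrightarrow>
    has_bochner_integral (lebesgue_on A) H c"
proof -
  have "integrable (lebesgue_on A) H \<longleftrightarrow> H absolutely_integrable_on A"
    using assms by (simp add: integrable_restrict_space set_integrable_def)
  moreover have "integral\<^sup>L (lebesgue_on A) H = integral A H" if "H absolutely_integrable_on A"
    using that assms set_lebesgue_integral_eq_integral(2)[OF that]
    by (simp add: integral_restrict_space set_lebesgue_integral_def)
  ultimately show ?thesis
    by (auto simp: has_bochner_integral_iff)
qed

text \<open>
  The real Jacobian determinant of a holomorphic function is the squared modulus of its
  derivative. As an equivalence of two statements about existence and value of an integral,
  the formula transports integrability along with the integral.
\<close>

theorem holomorphic_change_of_variables:
  fixes f F :: "complex \<Rightarrow> complex"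
  assumes "open S" and holo: "f holomorphic_on S" and inj: "inj_on f S"
  shows "has_bochner_integral (lebesgue_on (f ` S)) F b \<longleftrightarrow>
    has_bochner_integral (lebesgue_on S) (\<lambda>z. (cmod (deriv f z))\<^sup>2 *\<^sub>R F (f z)) b"
proof -
  let ?V = vec_of_complex and ?C = complex_of_vec
  define G where "G = (\<lambda>x. ?V (f (?C x)))"
  define G' where "G' = (\<lambda>x h. ?V (deriv f (?C x) * ?C h))"
  have openV: "open (?V ` U)" if "open U" for U
  proof -
    have "?V ` U = ?C -` U"
      by (force simp: image_iff intro: bexI[of _ "?C _"])
    then show ?thesis
      using that bounded_linear_complex_of_vec
      by (simp add: continuous_open_vimage linear_continuous_at)
  qed
  have "open (f ` S)"
    using assms by (intro open_mapping_thm3)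
  then have leb: "S \<in> sets lebesgue" "?V ` S \<in> sets lebesgue"
      "f ` S \<in> sets lebesgue" "?V ` f ` S \<in> sets lebesgue"
    using openV \<open>open S\<close> by auto
  have img: "G ` ?V ` S = ?V ` f ` S"
    by (simp add: G_def image_image)
  have der: "(G has_derivative G' x) (at x within ?V ` S)" if x: "x \<in> ?V ` S" for x
  proof -
    have "?C x \<in> S" using x by auto
    then have "(f has_derivative (*) (deriv f (?C x))) (at (?C x))"
      using holomorphic_derivI[OF holo \<open>open S\<close>] by (simp add: has_field_derivative_def)
    from has_derivative_compose[OF bounded_linear.has_derivative[OF bounded_linear_complex_of_vec
      has_derivative_ident] this]
    show ?thesis
      unfolding G_def G'_def
      by (intro bounded_linear.has_derivative[OF bounded_linear_vec_of_complex])
        (rule has_derivative_at_withinI)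
  qed
  have injG: "inj_on G (?V ` S)"
    unfolding G_def inj_on_def using inj
    by (auto dest: inj_onD dest!: arg_cong[of "?V _" "?V _" ?C])
  have det: "\<bar>det (matrix (G' x))\<bar> = (cmod (deriv f (?C x)))\<^sup>2" for x
    by (simp add: det_2 matrix_def G'_def vec_of_complex_def complex_of_vec_def axis_def
      cmod_power2 flip: power2_eq_square)
  have lin: "r *\<^sub>R ?V z = ?V (r *\<^sub>R z)" for r z
    by (simp add: linear_cmul[OF bounded_linear.linear[OF bounded_linear_vec_of_complex]])
  have "has_bochner_integral (lebesgue_on (f ` S)) F b \<longleftrightarrow>
      has_bochner_integral (lebesgue_on (?V ` f ` S)) (\<lambda>x. ?V (F (?C x))) (?V b)"
    using leb by (simp add: has_bochner_integral_lebesgue_on_vec)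
  also have "\<dots> \<longleftrightarrow> has_bochner_integral (lebesgue_on (?V ` S))
      (\<lambda>x. ?V ((cmod (deriv f (?C x)))\<^sup>2 *\<^sub>R F (f (?C x)))) (?V b)"
    using has_absolute_integral_change_of_variables[OF leb(2) der injG, of "\<lambda>x. ?V (F (?C x))" "?V b"] leb
    by (simp add: absolutely_integrable_iff_has_bochner_integral img det lin)
       (simp add: G_def)
  also have "\<dots> \<longleftrightarrow> has_bochner_integral (lebesgue_on S)
      (\<lambda>z. (cmod (deriv f z))\<^sup>2 *\<^sub>R F (f z)) b"
    using leb by (intro has_bochner_integral_lebesgue_on_vec)
  finally show ?thesis .
qed

corollary holomorphic_change_of_variables_real:
  fixes F :: "complex \<Rightarrow> real"
  assumes "open S" "f holomorphic_on S" "inj_on f S"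
  shows "has_bochner_integral (lebesgue_on (f ` S)) F b \<longleftrightarrow>
    has_bochner_integral (lebesgue_on S) (\<lambda>z. (cmod (deriv f z))\<^sup>2 * F (f z)) b"
proof -
  have of_real: "has_bochner_integral M (\<lambda>x. complex_of_real (K x)) (of_real b) \<longleftrightarrow>
      has_bochner_integral M K b" for M and K :: "complex \<Rightarrow> real"
    using has_bochner_integral_bounded_linear[OF bounded_linear_of_real, of M K b]
      has_bochner_integral_bounded_linear[OF bounded_linear_Re, of M "\<lambda>x. complex_of_real (K x)" "of_real b"]
    by auto
  show ?thesis
    using holomorphic_change_of_variables[OF assms, of "\<lambda>x. of_real (F x)" "of_real b"]
    unfolding scaleR_conv_of_real of_real_mult[symmetric] of_real .
qed

section \<open>Smooth functions and the transport of test functions\<close>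

lemma Ck_on_SucD: "Ck_on (Suc k) U \<phi> \<Longrightarrow> Ck_on k U \<phi>"
proof (induction k arbitrary: \<phi>)
  case 0
  then show ?case
    by (auto intro!: continuous_at_imp_continuous_on differentiable_imp_continuous_within)
next
  case (Suc k)
  from Suc.prems have "\<forall>x\<in>U. \<phi> differentiable (at x)"
    and "Ck_on (Suc k) U (\<lambda>x. frechet_derivative \<phi> (at x) e)" if "e \<in> Basis" for e
    using that unfolding Ck_on.simps(2)[of "Suc k"] by blast+
  with Suc.IH show ?case
    unfolding Ck_on.simps(2)[of k U \<phi>] by blast
qed

lemma Ck_on_cong:
  assumes "open U" and "\<And>x. x \<in> U \<Longrightarrow> \<phi> x = \<psi> x" and "Ck_on k U \<phi>"
  shows "Ck_on k U \<psi>"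
  using assms(2,3)
proof (induction k arbitrary: \<phi> \<psi>)
  case 0
  then show ?case
    using continuous_on_cong[of U U \<phi> \<psi>] by simp
next
  case (Suc k)
  have "\<psi> differentiable (at x)" if "x \<in> U" for x
  proof -
    have "(\<phi> has_derivative frechet_derivative \<phi> (at x)) (at x)"
      using Suc.prems that by (simp add: frechet_derivative_works)
    from has_derivative_transform_within_open[OF this \<open>open U\<close> that] show ?thesis
      using Suc.prems(1) by (auto simp: differentiable_def)
  qed
  moreover have eq: "frechet_derivative \<phi> (at x) = frechet_derivative \<psi> (at x)" if "x \<in> U" for x
    using Suc.prems that \<open>open U\<close> by (intro frechet_derivative_transform_within_open[of _ _ U]) auto
  have "Ck_on k U (\<lambda>x. frechet_derivative \<psi> (at x) e)" if "e \<in> Basis" for e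
  proof (rule Suc.IH[rotated])
    show "Ck_on k U (\<lambda>x. frechet_derivative \<phi> (at x) e)"
      using Suc.prems(2) that by simp
  qed (simp add: eq)
  ultimately show ?case
    by auto
qed

text \<open>
  Differentiability classes are defined through \<^const>\<open>frechet_derivative\<close>; this rule lets an
  explicit formula for the derivative take its place in the inductions that follow.
\<close>

lemma Ck_on_SucI:
  assumes "open U" and "\<And>x. x \<in> U \<Longrightarrow> (\<phi> has_derivative \<phi>' x) (at x)"
    and "\<And>e. e \<in> Basis \<Longrightarrow> Ck_on k U (\<lambda>x. \<phi>' x e)"
  shows "Ck_on (Suc k) U \<phi>"
proof -
  have "Ck_on k U (\<lambda>x. frechet_derivative \<phi> (at x) e)" if "e \<in> Basis" for e
    by (rule Ck_on_cong[of U "\<lambda>x. \<phi>' x e"])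
      (use assms that in \<open>auto intro: fun_cong[OF frechet_derivative_at]\<close>)
  then show ?thesis
    using assms(2) by (auto simp: differentiable_def)
qed

lemma Ck_on_Suc_has_derivative:
  assumes "Ck_on (Suc k) U \<phi>" "x \<in> U"
  shows "(\<phi> has_derivative frechet_derivative \<phi> (at x)) (at x)"
  using assms by (simp add: frechet_derivative_works)

lemma Ck_on_const: "open U \<Longrightarrow> Ck_on k U (\<lambda>_. c)"
proof (induction k arbitrary: c)
  case (Suc k)
  show ?case
    by (rule Ck_on_SucI[OF \<open>open U\<close> has_derivative_const Suc.IH[OF \<open>open U\<close>]])
qed simp

lemma Ck_on_add:
  assumes "open U" "Ck_on k U \<phi>" "Ck_on k U \<psi>"
  shows "Ck_on k U (\<lambda>x. \<phi> x + \<psi> x)"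
  using assms(2,3)
proof (induction k arbitrary: \<phi> \<psi>)
  case (Suc k)
  note d = Ck_on_Suc_has_derivative[OF Suc.prems(1)] Ck_on_Suc_has_derivative[OF Suc.prems(2)]
  show ?case
    using Suc.prems by (intro Ck_on_SucI[OF \<open>open U\<close> has_derivative_add[OF d]] Suc.IH) auto
qed (auto intro: continuous_on_add)

lemma Ck_on_mult:
  assumes "open U" "Ck_on k U \<phi>" "Ck_on k U \<psi>"
  shows "Ck_on k U (\<lambda>x. \<phi> x * \<psi> x)"
  using assms(2,3)
proof (induction k arbitrary: \<phi> \<psi>)
  case (Suc k)
  note d = Ck_on_Suc_has_derivative[OF Suc.prems(1)] Ck_on_Suc_has_derivative[OF Suc.prems(2)]
  show ?case
    using Suc.prems Suc.prems[THEN Ck_on_SucD]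
    by (intro Ck_on_SucI[OF \<open>open U\<close> has_derivative_mult[OF d]] Ck_on_add \<open>open U\<close> Suc.IH) auto
qed (auto intro: continuous_on_mult)

lemma Ck_on_Re_holomorphic:
  assumes "open U" "h holomorphic_on U"
  shows "Ck_on k U (\<lambda>x. Re (h x))"
  using assms(2)
proof (induction k arbitrary: h)
  case 0
  then show ?case
    by (auto intro!: continuous_intros holomorphic_on_imp_continuous_on)
next
  case (Suc k)
  have "((\<lambda>x. Re (h x)) has_derivative (\<lambda>e. Re (deriv h x * e))) (at x)" if "x \<in> U" for x
    using holomorphic_derivI[OF Suc.prems \<open>open U\<close> that]
    by (intro bounded_linear.has_derivative[OF bounded_linear_Re])
      (simp add: has_field_derivative_def)
  moreover have "(\<lambda>x. deriv h x * e) holomorphic_on U" for e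
    using Suc.prems \<open>open U\<close> by (intro holomorphic_on_mult holomorphic_deriv holomorphic_on_const)
  ultimately show ?case
    using Suc.IH by (intro Ck_on_SucI[OF \<open>open U\<close>]) blast+
qed

lemma Ck_on_Im_holomorphic:
  assumes "open U" "h holomorphic_on U"
  shows "Ck_on k U (\<lambda>x. Im (h x))"
proof -
  have "(\<lambda>x. - \<i> * h x) holomorphic_on U"
    using assms(2) by (intro holomorphic_on_mult holomorphic_on_const)
  from Ck_on_Re_holomorphic[OF assms(1) this] show ?thesis
    by simp
qed

lemma linear_complex_decompose:
  fixes L :: "complex \<Rightarrow> real"
  assumes "linear L"
  shows "L h = Re h * L 1 + Im h * L \<i>"
proof -
  have "h = Re h *\<^sub>R 1 + Im h *\<^sub>R \<i>"
    by (simp add: complex_eq_iff)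
  then have "L h = L (Re h *\<^sub>R 1 + Im h *\<^sub>R \<i>)"
    by (rule arg_cong)
  then show ?thesis
    using assms by (simp add: linear_add linear_cmul)
qed

text \<open>
  By the chain rule the directional derivative of \<open>\<phi> \<circ> g\<close> along \<open>e\<close> is
  \<open>Re (g' e) (\<partial>\<^sub>x \<phi> \<circ> g) + Im (g' e) (\<partial>\<^sub>y \<phi> \<circ> g)\<close>, a combination of harmonic functions with
  composites of the same kind, to which the induction on \<open>k\<close> applies.
\<close>

lemma Ck_on_compose_holomorphic:
  assumes "open U" "g holomorphic_on U" "g ` U \<subseteq> S" "Ck_on k S \<phi>"
  shows "Ck_on k U (\<lambda>x. \<phi> (g x))"
  using assms(4)
proof (induction k arbitrary: \<phi>)
  case 0
  with assms show ?case
    using continuous_on_compose2[of S \<phi> U g] by (auto intro: holomorphic_on_imp_continuous_on)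
next
  case (Suc k)
  define p where "p = (\<lambda>x e. frechet_derivative \<phi> (at (g x)) e)"
  have "((\<lambda>x. \<phi> (g x)) has_derivative
      (\<lambda>e. Re (deriv g x * e) * p x 1 + Im (deriv g x * e) * p x \<i>)) (at x)" if "x \<in> U" for x
  proof -
    have "(\<phi> has_derivative p x) (at (g x))"
      using Ck_on_Suc_has_derivative[OF Suc.prems] that assms(3) by (auto simp: p_def)
    then have "((\<lambda>x. \<phi> (g x)) has_derivative (\<lambda>e. p x (deriv g x * e))) (at x)"
      using holomorphic_derivI[OF assms(2,1) that]
        has_derivative_compose[of g "(*) (deriv g x)" x UNIV \<phi> "p x"]
      by (simp add: has_field_derivative_def)
    moreover have "linear (p x)"
      using \<open>(\<phi> has_derivative p x) (at (g x))\<close> by (rule has_derivative_linear)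
    ultimately show ?thesis
      by (simp add: linear_complex_decompose[of "p x" "deriv g x * e" for e])
  qed
  moreover have p: "Ck_on k U (\<lambda>x. p x e)" if "e \<in> Basis" for e
    unfolding p_def using Suc.prems that by (intro Suc.IH[of "\<lambda>y. frechet_derivative \<phi> (at y) e"]) auto
  ultimately show ?case
    using assms(1,2)
  proof (intro Ck_on_SucI[OF \<open>open U\<close>])
    fix e :: complex assume "e \<in> Basis"
    have "(\<lambda>x. deriv g x * e) holomorphic_on U"
      using assms(1,2) by (intro holomorphic_on_mult holomorphic_deriv holomorphic_on_const)
    with p show "Ck_on k U (\<lambda>x. Re (deriv g x * e) * p x 1 + Im (deriv g x * e) * p x \<i>)"
      using \<open>open U\<close>
      by (intro Ck_on_add Ck_on_mult Ck_on_Re_holomorphic Ck_on_Im_holomorphic)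
        (simp_all add: Basis_complex_def)
  qed
qed

lemma Ck_on_Un:
  assumes "open U" "open V" "Ck_on k U \<phi>" "Ck_on k V \<phi>"
  shows "Ck_on k (U \<union> V) \<phi>"
  using assms(3,4)
proof (induction k arbitrary: \<phi>)
  case 0
  with assms(1,2) show ?case
    by (simp add: continuous_on_open_Un)
next
  case (Suc k)
  then show ?case
    unfolding Ck_on.simps(2) by blast
qed

text \<open>
  The extension is smooth because the two open sets \<open>S\<close>, where it is \<open>\<eta>\<close>, and \<open>- K\<close>, where it
  vanishes, cover the plane.
\<close>

lemma test_function_zero_extension:
  assumes "open S" "smooth_on S \<eta>" "compact K" "K \<subseteq> S"
    and zero: "\<And>x. x \<in> S - K \<Longrightarrow> \<eta> x = 0"
  shows "test_function S (\<lambda>x. if x \<in> S then \<eta> x else 0)" (is "test_function S ?\<phi>")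
proof -
  have "Ck_on k UNIV ?\<phi>" for k
  proof -
    have "open (- K)"
      using \<open>compact K\<close> by (simp add: compact_imp_closed open_Compl)
    have "Ck_on k S ?\<phi>"
      by (rule Ck_on_cong[of S \<eta>]) (use assms in \<open>auto simp: smooth_on_def\<close>)
    moreover have "Ck_on k (- K) ?\<phi>"
      by (rule Ck_on_cong[OF \<open>open (- K)\<close> _ Ck_on_const[OF \<open>open (- K)\<close>], of 0])
        (use zero in auto)
    moreover have "S \<union> - K = UNIV"
      using \<open>K \<subseteq> S\<close> by auto
    ultimately show ?thesis
      using Ck_on_Un[OF \<open>open S\<close> \<open>open (- K)\<close>] by metis
  qed
  moreover have supp: "closure {x. ?\<phi> x \<noteq> 0} \<subseteq> K"
    using zero \<open>compact K\<close> by (intro closure_minimal compact_imp_closed) (auto split: if_splits)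
  moreover have "compact (closure {x. ?\<phi> x \<noteq> 0})"
    using supp \<open>compact K\<close> by (meson bounded_subset closed_closure compact_eq_bounded_closed)
  ultimately show ?thesis
    using \<open>K \<subseteq> S\<close> by (auto simp: test_function_def smooth_on_def)
qed

text \<open>
  The support of \<open>c \<cdot> (\<psi> \<circ> g)\<close> lies in the image under \<open>f\<close>, a continuous inverse of \<open>g\<close>, of the
  support of \<open>\<psi>\<close>, hence is compact. The smooth factor \<open>c\<close> allows for the real and imaginary
  parts of \<open>g'\<close>.
\<close>

lemma test_function_pullback:
  assumes "open T" "g holomorphic_on T" "g ` T \<subseteq> S" "continuous_on S f" "f ` S \<subseteq> T"
    and fg: "\<And>x. x \<in> T \<Longrightarrow> f (g x) = x"
    and c: "\<And>k. Ck_on k T c" and \<psi>: "test_function S \<psi>"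
  shows "test_function T (\<lambda>x. if x \<in> T then c x * \<psi> (g x) else 0)"
proof (rule test_function_zero_extension)
  let ?K = "closure {x. \<psi> x \<noteq> 0}"
  have K: "compact ?K" "?K \<subseteq> S" and smooth: "Ck_on k UNIV \<psi>" for k
    using \<psi> by (auto simp: test_function_def smooth_on_def)
  show "compact (f ` ?K)"
    using K assms(4) by (intro compact_continuous_image) (auto intro: continuous_on_subset)
  show "f ` ?K \<subseteq> T"
    using K assms(5) by auto
  show "c x * \<psi> (g x) = 0" if "x \<in> T - f ` ?K" for x
  proof -
    have "g x \<notin> ?K"
      using that fg[of x] by (metis DiffD1 DiffD2 imageI)
    then show ?thesis
      using closure_subset[of "{x. \<psi> x \<noteq> 0}"] by auto
  qed
  show "smooth_on T (\<lambda>x. c x * \<psi> (g x))"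
    unfolding smooth_on_def using assms smooth
    by (intro allI Ck_on_mult Ck_on_compose_holomorphic[of T g UNIV]) auto
qed fact

lemma grad_eqI:
  assumes "(\<phi> has_derivative (\<lambda>h. h \<bullet> p)) (at x)"
  shows "grad \<phi> x = p"
  using frechet_derivative_at[OF assms, symmetric]
  by (simp add: grad_def euclidean_representation inner_commute[of _ p])

lemma has_derivative_grad:
  assumes "\<phi> differentiable (at x)"
  shows "(\<phi> has_derivative (\<lambda>h. h \<bullet> grad \<phi> x)) (at x)"
proof -
  have "(\<phi> has_derivative frechet_derivative \<phi> (at x)) (at x)"
    using assms by (simp add: frechet_derivative_works)
  moreover from this have "linear (frechet_derivative \<phi> (at x))"
    by (rule has_derivative_linear)
  then have "frechet_derivative \<phi> (at x) h = h \<bullet> grad \<phi> x" for h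
    by (subst linear_complex_decompose) (simp_all add: grad_def Basis_complex_def inner_complex_def)
  then have "frechet_derivative \<phi> (at x) = (\<lambda>h. h \<bullet> grad \<phi> x)" ..
  ultimately show ?thesis
    by simp
qed

lemma continuous_on_grad:
  assumes "smooth_on UNIV \<phi>"
  shows "continuous_on UNIV (grad \<phi>)"
proof -
  have "Ck_on (Suc 0) UNIV \<phi>"
    using assms by (simp add: smooth_on_def)
  then show ?thesis
    unfolding grad_def[abs_def] by (auto intro!: continuous_intros)
qed

lemma grad_eq_0_outside_support:
  assumes "x \<notin> closure {x. \<phi> x \<noteq> 0}"
  shows "grad \<phi> x = 0"
proof (rule grad_eqI)
  have "((\<lambda>_. 0) has_derivative (\<lambda>h. h \<bullet> 0)) (at x)"
    by simp
  then show "(\<phi> has_derivative (\<lambda>h. h \<bullet> 0)) (at x)"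
    by (rule has_derivative_transform_within_open[of _ _ _ _ "- closure {x. \<phi> x \<noteq> 0}"])
      (use assms closure_subset[of "{x. \<phi> x \<noteq> 0}"] in auto)
qed

text \<open>
  From \<open>|u| |G| \<le> |u|\<^sup>2 + |G|\<^sup>2\<close>.
\<close>

lemma integrable_scaleR_of_L2:
  fixes G :: "complex \<Rightarrow> 'b::euclidean_space"
  assumes "L2_on S u" "L2_on S G"
  shows "integrable (lebesgue_on S) (\<lambda>x. u x *\<^sub>R G x)"
proof (rule Bochner_Integration.integrable_bound)
  show "integrable (lebesgue_on S) (\<lambda>x. (norm (u x))\<^sup>2 + (norm (G x))\<^sup>2)"
    using assms by (auto simp: L2_on_def)
  show "(\<lambda>x. u x *\<^sub>R G x) \<in> borel_measurable (lebesgue_on S)"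
    using assms by (auto simp: L2_on_def)
  have "norm (u x *\<^sub>R G x) \<le> (norm (u x))\<^sup>2 + (norm (G x))\<^sup>2" for x
    using sum_squares_bound[of "norm (u x)" "norm (G x)"]
      mult_nonneg_nonneg[OF norm_ge_zero[of "u x"] norm_ge_zero[of "G x"]]
    unfolding norm_scaleR real_norm_def by linarith
  then show "AE x in lebesgue_on S. norm (u x *\<^sub>R G x) \<le> norm ((norm (u x))\<^sup>2 + (norm (G x))\<^sup>2)"
    by simp
qed

lemma L2_on_compact_support:
  fixes G :: "complex \<Rightarrow> 'b::euclidean_space"
  assumes "S \<in> sets lebesgue" "continuous_on UNIV G" "compact K" and zero: "\<And>x. x \<notin> K \<Longrightarrow> G x = 0"
  shows "L2_on S G"
proof -
  have "integrable lborel (\<lambda>x. indicator K x *\<^sub>R (norm (G x))\<^sup>2)"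
    using assms(2,3)
    by (intro borel_integrable_compact) (auto intro!: continuous_intros intro: continuous_on_subset)
  also have "(\<lambda>x. indicator K x *\<^sub>R (norm (G x))\<^sup>2) = (\<lambda>x. (norm (G x))\<^sup>2)"
    using zero by (auto simp: indicator_def fun_eq_iff)
  finally have "integrable lebesgue (\<lambda>x. (norm (G x))\<^sup>2)"
    using borel_measurable_integrable by (subst integrable_completion) blast+
  then have "integrable (lebesgue_on S) (\<lambda>x. (norm (G x))\<^sup>2)"
    using assms(1) integrable_mult_indicator[of S lebesgue "\<lambda>x. (norm (G x))\<^sup>2"]
    by (simp add: integrable_restrict_space)
  moreover have "G \<in> borel_measurable (lebesgue_on S)"
    using assms(1,2) by (intro continuous_imp_measurable_on_sets_lebesgue) (auto intro: continuous_on_subset)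
  ultimately show ?thesis
    by (simp add: L2_on_def)
qed

lemma test_function_L2:
  assumes "test_function T \<phi>" "S \<in> sets lebesgue"
  shows "L2_on S \<phi>" "L2_on S (grad \<phi>)"
proof -
  let ?K = "closure {x. \<phi> x \<noteq> 0}"
  have K: "compact ?K" and smooth: "smooth_on UNIV \<phi>"
    using assms(1) by (auto simp: test_function_def)
  have "Ck_on 0 UNIV \<phi>"
    using smooth unfolding smooth_on_def by blast
  then show "L2_on S \<phi>"
    using closure_subset[of "{x. \<phi> x \<noteq> 0}"]
    by (intro L2_on_compact_support[OF assms(2) _ K]) auto
  show "L2_on S (grad \<phi>)"
    by (rule L2_on_compact_support[OF assms(2) continuous_on_grad[OF smooth] K])
      (rule grad_eq_0_outside_support)
qed

section \<open>Conformal invariance of the Dirichlet integral\<close>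

lemma has_weak_gradient_cong:
  assumes "\<And>x. x \<in> S \<Longrightarrow> u x = v x" and u: "has_weak_gradient S u g"
  shows "has_weak_gradient S v g"
proof -
  have "v \<in> borel_measurable (lebesgue_on S) \<longleftrightarrow> u \<in> borel_measurable (lebesgue_on S)"
    using assms(1) by (intro measurable_cong) simp
  moreover have "integrable (lebesgue_on S) (\<lambda>x. (norm (v x))\<^sup>2) \<longleftrightarrow>
      integrable (lebesgue_on S) (\<lambda>x. (norm (u x))\<^sup>2)"
    using assms(1) by (intro Bochner_Integration.integrable_cong) auto
  moreover have "(LINT x|lebesgue_on S. v x *\<^sub>R grad \<phi> x) = (LINT x|lebesgue_on S. u x *\<^sub>R grad \<phi> x)" for \<phi>
    using assms(1) by (intro Bochner_Integration.integral_cong) auto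
  ultimately show ?thesis
    using u by (simp add: has_weak_gradient_def L2_on_def)
qed

text \<open>
  A continuous map need not pull Lebesgue sets back to Lebesgue sets. Here preimages under \<open>f\<close>
  are images under the differentiable map \<open>g\<close>, and differentiable maps between spaces of equal
  dimension send Lebesgue sets to Lebesgue sets.
\<close>

lemma measurable_lebesgue_on_holomorphic:
  assumes "open S" "f holomorphic_on S" "open T" "g holomorphic_on T"
    and maps: "f ` S \<subseteq> T" "g ` T \<subseteq> S"
    and inv: "\<And>z. z \<in> S \<Longrightarrow> g (f z) = z" "\<And>x. x \<in> T \<Longrightarrow> f (g x) = x"
  shows "f \<in> lebesgue_on S \<rightarrow>\<^sub>M lebesgue_on T"
proof (rule measurableI)
  fix A assume "A \<in> sets (lebesgue_on T)"
  then have A: "A \<in> sets lebesgue" "A \<subseteq> T"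
    using \<open>open T\<close> by (auto simp: sets_restrict_space_iff)
  have "g differentiable_on A"
    using holomorphic_on_imp_differentiable_at[OF assms(4,3)] A(2)
    by (meson differentiable_at_imp_differentiable_on field_differentiable_imp_differentiable subsetD)
  then have "g ` A \<in> sets lebesgue"
    using A(1) by (intro differentiable_image_in_sets_lebesgue) auto
  moreover have "f -` A \<inter> S = g ` A"
    using A(2) maps inv by (force simp: image_iff)
  ultimately show "f -` A \<inter> space (lebesgue_on S) \<in> sets (lebesgue_on S)"
    using \<open>open S\<close> by (auto simp: sets_restrict_space_iff)
qed (use maps(1) in auto)

text \<open>
  With gradients written as complex numbers and \<open>h\<close> holomorphic, the gradient of \<open>Re h\<close> is
  \<open>cnj h'\<close>, that of \<open>Im h\<close> is \<open>\<i> cnj h'\<close>, and the chain rule reads \<open>\<nabla>(\<psi> \<circ> g) = cnj g' \<cdot> (\<nabla>\<psi> \<circ> g)\<close>. In the combination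
  of the first gradient with \<open>\<i>\<close> times the second, the terms with \<open>g''\<close> cancel.
\<close>

lemma
  assumes "open T" "g holomorphic_on T" and x: "x \<in> T" and \<psi>: "\<psi> differentiable (at (g x))"
  shows grad_Re_deriv_pullback: "grad (\<lambda>x. if x \<in> T then Re (deriv g x) * \<psi> (g x) else 0) x =
      \<psi> (g x) *\<^sub>R cnj (deriv (deriv g) x) + Re (deriv g x) *\<^sub>R (cnj (deriv g x) * grad \<psi> (g x))"
    and grad_Im_deriv_pullback: "grad (\<lambda>x. if x \<in> T then Im (deriv g x) * \<psi> (g x) else 0) x =
      \<psi> (g x) *\<^sub>R (\<i> * cnj (deriv (deriv g) x)) + Im (deriv g x) *\<^sub>R (cnj (deriv g x) * grad \<psi> (g x))"
proof -
  have g: "(g has_derivative (*) (deriv g x)) (at x)"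
    using holomorphic_derivI[OF assms(2,1) x] by (simp add: has_field_derivative_def)
  have g': "(deriv g has_derivative (*) (deriv (deriv g) x)) (at x)"
    using holomorphic_derivI[OF holomorphic_deriv[OF assms(2,1)] assms(1) x]
    by (simp add: has_field_derivative_def)
  have \<psi>g: "((\<lambda>x. \<psi> (g x)) has_derivative (\<lambda>h. (deriv g x * h) \<bullet> grad \<psi> (g x))) (at x)"
    using has_derivative_compose[OF g has_derivative_grad[OF \<psi>]] .
  have "((\<lambda>x. Re (deriv g x) * \<psi> (g x)) has_derivative
      (\<lambda>h. Re (deriv g x) * ((deriv g x * h) \<bullet> grad \<psi> (g x)) +
           Re (deriv (deriv g) x * h) * \<psi> (g x))) (at x)"
    by (rule has_derivative_mult[OF bounded_linear.has_derivative[OF bounded_linear_Re g'] \<psi>g])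
  from has_derivative_transform_within_open[OF this assms(1) x,
    of "\<lambda>x. if x \<in> T then Re (deriv g x) * \<psi> (g x) else 0"]
  show "grad (\<lambda>x. if x \<in> T then Re (deriv g x) * \<psi> (g x) else 0) x =
      \<psi> (g x) *\<^sub>R cnj (deriv (deriv g) x) + Re (deriv g x) *\<^sub>R (cnj (deriv g x) * grad \<psi> (g x))"
    by (intro grad_eqI) (simp add: inner_complex_def algebra_simps)
  have "((\<lambda>x. Im (deriv g x) * \<psi> (g x)) has_derivative
      (\<lambda>h. Im (deriv g x) * ((deriv g x * h) \<bullet> grad \<psi> (g x)) +
           Im (deriv (deriv g) x * h) * \<psi> (g x))) (at x)"
    by (rule has_derivative_mult[OF bounded_linear.has_derivative[OF bounded_linear_Im g'] \<psi>g])
  from has_derivative_transform_within_open[OF this assms(1) x,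
    of "\<lambda>x. if x \<in> T then Im (deriv g x) * \<psi> (g x) else 0"]
  show "grad (\<lambda>x. if x \<in> T then Im (deriv g x) * \<psi> (g x) else 0) x =
      \<psi> (g x) *\<^sub>R (\<i> * cnj (deriv (deriv g) x)) + Im (deriv g x) *\<^sub>R (cnj (deriv g x) * grad \<psi> (g x))"
    by (intro grad_eqI) (simp add: inner_complex_def algebra_simps)
qed

lemma test_function_differentiable:
  assumes "test_function S \<psi>"
  shows "\<psi> differentiable (at x)"
proof -
  have "Ck_on (Suc 0) UNIV \<psi>"
    using assms unfolding test_function_def smooth_on_def by blast
  then show ?thesis
    by simp
qed

text \<open>
  Chain rule and invariance of the Dirichlet integral under a univalent map \<open>f\<close>. Square
  integrability of \<open>v \<circ> f\<close> has to be assumed, since a degenerating \<open>f'\<close> could destroy it; for the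
  gradient it is automatic, as the factor \<open>|f'|\<^sup>2\<close> is exactly the Jacobian.
\<close>

theorem weak_gradient_conformal_pullback:
  fixes v :: "complex \<Rightarrow> real"
  assumes "open S" and holo: "f holomorphic_on S" and inj: "inj_on f S"
    and v: "has_weak_gradient (f ` S) v k" and L2: "L2_on S (\<lambda>z. v (f z))"
  defines "h \<equiv> \<lambda>z. cnj (deriv f z) * k (f z)"
  shows "has_weak_gradient S (\<lambda>z. v (f z)) h"
    and "(LINT z|lebesgue_on S. (norm (h z))\<^sup>2) = (LINT x|lebesgue_on (f ` S). (norm (k x))\<^sup>2)"
proof -
  define T where "T = f ` S"
  obtain g where g: "g holomorphic_on T" and dfg: "\<And>z. z \<in> S \<Longrightarrow> deriv f z * deriv g (f z) = 1"
    and gf: "\<And>z. z \<in> S \<Longrightarrow> g (f z) = z"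
    using holomorphic_has_inverse[OF holo \<open>open S\<close> inj] unfolding T_def by blast
  have "open T"
    unfolding T_def using holo \<open>open S\<close> inj by (rule open_mapping_thm3)
  have fg: "\<And>x. x \<in> T \<Longrightarrow> f (g x) = x" and maps: "f ` S \<subseteq> T" "g ` T \<subseteq> S" and inj_g: "inj_on g T"
    using gf by (auto simp: T_def inj_on_def)
  have gT: "g ` T = S"
    using gf by (simp add: T_def image_image)
  have dgf: "deriv g x * deriv f (g x) = 1" if "x \<in> T" for x
    using that dfg[of "g x"] fg[OF that] maps by (auto simp: mult.commute)
  have kL2: "L2_on T k" and vL2: "L2_on T v"
    using v by (auto simp: has_weak_gradient_def T_def)
  have leb: "S \<in> sets lebesgue" "T \<in> sets lebesgue"
    using \<open>open S\<close> \<open>open T\<close> by auto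

  have normh: "(norm (h z))\<^sup>2 = (cmod (deriv f z))\<^sup>2 * (norm (k (f z)))\<^sup>2" for z
    by (simp add: h_def norm_mult power_mult_distrib)
  have energy: "has_bochner_integral (lebesgue_on S) (\<lambda>z. (norm (h z))\<^sup>2)
      (LINT x|lebesgue_on T. (norm (k x))\<^sup>2)"
    unfolding normh
    using holomorphic_change_of_variables_real[OF \<open>open S\<close> holo inj, of "\<lambda>x. (norm (k x))\<^sup>2"]
      has_bochner_integral_integrable[of "lebesgue_on T" "\<lambda>x. (norm (k x))\<^sup>2"] kL2
    by (simp add: L2_on_def flip: T_def)
  then show "(LINT z|lebesgue_on S. (norm (h z))\<^sup>2) = (LINT x|lebesgue_on (f ` S). (norm (k x))\<^sup>2)"
    by (simp add: has_bochner_integral_integral_eq T_def)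

  have "(\<lambda>z. k (f z)) \<in> borel_measurable (lebesgue_on S)"
    using measurable_compose[OF
      measurable_lebesgue_on_holomorphic[OF \<open>open S\<close> holo \<open>open T\<close> g maps gf fg], of k borel] kL2
    by (simp add: L2_on_def)
  moreover have "(\<lambda>z. cnj (deriv f z)) \<in> borel_measurable (lebesgue_on S)"
    using holomorphic_deriv[OF holo \<open>open S\<close>] leb
    by (intro continuous_imp_measurable_on_sets_lebesgue continuous_intros
      holomorphic_on_imp_continuous_on)
  ultimately have hL2: "L2_on S h"
    using energy by (auto simp: L2_on_def h_def has_bochner_integral_iff)

  have "(LINT z|lebesgue_on S. v (f z) *\<^sub>R grad \<psi> z) = - (LINT z|lebesgue_on S. \<psi> z *\<^sub>R h z)"
    if \<psi>: "test_function S \<psi>" for \<psi>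
  proof -
    \<comment> \<open>\<open>A + \<i> B = g' \<cdot> (\<psi> \<circ> g)\<close>, extended by zero.\<close>
    define A where "A = (\<lambda>x. if x \<in> T then Re (deriv g x) * \<psi> (g x) else 0)"
    define B where "B = (\<lambda>x. if x \<in> T then Im (deriv g x) * \<psi> (g x) else 0)"
    have g': "deriv g holomorphic_on T"
      using g \<open>open T\<close> by (rule holomorphic_deriv)
    have testA: "test_function T A" and testB: "test_function T B"
      unfolding A_def B_def
      by (rule test_function_pullback[OF \<open>open T\<close> g maps(2) _ maps(1) fg _ \<psi>],
          simp_all add: holomorphic_on_imp_continuous_on[OF holo]
            Ck_on_Re_holomorphic[OF \<open>open T\<close> g'] Ck_on_Im_holomorphic[OF \<open>open T\<close> g'])+
    have AB: "has_bochner_integral (lebesgue_on T) (\<lambda>x. v x *\<^sub>R grad C x)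
        (- (LINT x|lebesgue_on T. C x *\<^sub>R k x))"
        "has_bochner_integral (lebesgue_on T) (\<lambda>x. C x *\<^sub>R k x) (LINT x|lebesgue_on T. C x *\<^sub>R k x)"
      if "test_function T C" for C
      using that v kL2 test_function_L2[OF that leb(2)] integrable_scaleR_of_L2[OF vL2, of "grad C"]
        integrable_scaleR_of_L2[OF _ kL2, of C]
      by (auto simp: has_weak_gradient_def has_bochner_integral_iff T_def)
    define I where "I = (LINT x|lebesgue_on T. A x *\<^sub>R k x) + \<i> * (LINT x|lebesgue_on T. B x *\<^sub>R k x)"
    have sum: "grad A x + \<i> * grad B x = (cmod (deriv g x))\<^sup>2 *\<^sub>R grad \<psi> (g x)" if "x \<in> T" for x
    proof -
      have "grad A x + \<i> * grad B x =
          (Re (deriv g x) + \<i> * Im (deriv g x)) * (cnj (deriv g x) * grad \<psi> (g x))"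
        using test_function_differentiable[OF \<psi>] that \<open>open T\<close> g
        by (simp add: A_def B_def grad_Re_deriv_pullback grad_Im_deriv_pullback
          scaleR_conv_of_real algebra_simps)
      also have "Re (deriv g x) + \<i> * Im (deriv g x) = deriv g x"
        by (simp add: complex_eq_iff)
      finally show ?thesis
        by (simp add: scaleR_conv_of_real complex_norm_square mult.assoc del: of_real_power)
    qed
    \<comment> \<open>The Jacobian occurring here is that of \<open>g\<close>, so integrals over \<open>T\<close> are turned into integrals
      over \<open>S = g ` T\<close>.\<close>
    have "has_bochner_integral (lebesgue_on T)
        (\<lambda>x. v x *\<^sub>R grad A x + \<i> * (v x *\<^sub>R grad B x)) (- I)"
      using has_bochner_integral_add[OF AB(1)[OF testA]
        has_bochner_integral_mult_right[OF AB(1)[OF testB], of \<i>]]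
      by (simp add: I_def)
    also have "?this \<longleftrightarrow> has_bochner_integral (lebesgue_on T)
        (\<lambda>x. (cmod (deriv g x))\<^sup>2 *\<^sub>R (v (f (g x)) *\<^sub>R grad \<psi> (g x))) (- I)"
    proof (rule has_bochner_integral_cong)
      fix x assume "x \<in> space (lebesgue_on T)"
      then have "x \<in> T" by simp
      then show "v x *\<^sub>R grad A x + \<i> * (v x *\<^sub>R grad B x) =
          (cmod (deriv g x))\<^sup>2 *\<^sub>R (v (f (g x)) *\<^sub>R grad \<psi> (g x))"
        using arg_cong[OF sum, of x "scaleR (v x)"] fg
        by (simp add: scaleR_add_right mult.commute)
    qed simp_all
    also have "\<dots> \<longleftrightarrow> has_bochner_integral (lebesgue_on S) (\<lambda>z. v (f z) *\<^sub>R grad \<psi> z) (- I)"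
      using holomorphic_change_of_variables[OF \<open>open T\<close> g inj_g, of "\<lambda>z. v (f z) *\<^sub>R grad \<psi> z"]
      by (simp add: gT)
    finally have 1: "(LINT z|lebesgue_on S. v (f z) *\<^sub>R grad \<psi> z) = - I"
      by (rule has_bochner_integral_integral_eq)
    have "has_bochner_integral (lebesgue_on T) (\<lambda>x. A x *\<^sub>R k x + \<i> * (B x *\<^sub>R k x)) I"
      using has_bochner_integral_add[OF AB(2)[OF testA]
        has_bochner_integral_mult_right[OF AB(2)[OF testB], of \<i>]]
      by (simp add: I_def)
    also have "?this \<longleftrightarrow> has_bochner_integral (lebesgue_on T)
        (\<lambda>x. (cmod (deriv g x))\<^sup>2 *\<^sub>R (\<psi> (g x) *\<^sub>R h (g x))) I"
    proof (rule has_bochner_integral_cong)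
      fix x assume "x \<in> space (lebesgue_on T)"
      then have "x \<in> T" by simp
      have "A x *\<^sub>R k x + \<i> * (B x *\<^sub>R k x) =
          (Re (deriv g x) + \<i> * Im (deriv g x)) * (\<psi> (g x) *\<^sub>R k x)"
        using \<open>x \<in> T\<close> by (simp add: A_def B_def scaleR_conv_of_real algebra_simps)
      \<comment> \<open>Inserting \<open>g' (f' \<circ> g) = 1\<close>, conjugated, makes both the Jacobian \<open>|g'|\<^sup>2\<close> and the factor
        \<open>cnj f'\<close> of \<open>h\<close> visible.\<close>
      also have "Re (deriv g x) + \<i> * Im (deriv g x) = deriv g x * cnj (deriv g x * deriv f (g x))"
        using dgf[OF \<open>x \<in> T\<close>] by (simp add: complex_eq_iff)
      also have "\<dots> * (\<psi> (g x) *\<^sub>R k x) = (cmod (deriv g x))\<^sup>2 *\<^sub>R (\<psi> (g x) *\<^sub>R h (g x))"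
        using fg[OF \<open>x \<in> T\<close>]
        by (simp add: h_def scaleR_conv_of_real complex_norm_square mult_ac del: of_real_power)
      finally show "A x *\<^sub>R k x + \<i> * (B x *\<^sub>R k x) =
          (cmod (deriv g x))\<^sup>2 *\<^sub>R (\<psi> (g x) *\<^sub>R h (g x))" .
    qed simp_all
    also have "\<dots> \<longleftrightarrow> has_bochner_integral (lebesgue_on S) (\<lambda>z. \<psi> z *\<^sub>R h z) I"
      using holomorphic_change_of_variables[OF \<open>open T\<close> g inj_g, of "\<lambda>z. \<psi> z *\<^sub>R h z"]
      by (simp add: gT)
    finally have "(LINT z|lebesgue_on S. \<psi> z *\<^sub>R h z) = I"
      by (rule has_bochner_integral_integral_eq)
    with 1 show ?thesis
      by simp
  qed
  with L2 hL2 show "has_weak_gradient S (\<lambda>z. v (f z)) h"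
    by (simp add: has_weak_gradient_def)
qed

section \<open>The eigenvalue inequality\<close>

lemma two_Re_minus_one_le_norm_square: "2 * Re w - 1 \<le> (cmod w)\<^sup>2"
  using sum_power2_ge_zero[of "Re w - 1" "Im w"] by (simp add: cmod_power2 power2_diff)

text \<open>
  The pointwise bound \<open>2 Re w - 1 \<le> |w|\<^sup>2\<close>, integrated against the probability density \<open>\<phi>\<^sup>2\<close>.
  Applied to \<open>w\<close> and \<open>- w\<close> it also dominates \<open>|Re w|\<close>, which makes \<open>\<phi>\<^sup>2 Re w\<close> integrable.
\<close>

lemma two_integral_Re_minus_one_le:
  fixes \<phi> :: "complex \<Rightarrow> real"
  assumes \<phi>: "integrable M (\<lambda>x. (\<phi> x)\<^sup>2)" "(LINT x|M. (\<phi> x)\<^sup>2) = 1"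
    and w: "integrable M (\<lambda>x. (cmod (w x))\<^sup>2 * (\<phi> x)\<^sup>2)"
    and meas: "\<phi> \<in> borel_measurable M" "w \<in> borel_measurable M"
  shows "2 * (LINT x|M. (\<phi> x)\<^sup>2 * Re (w x)) - 1 \<le> (LINT x|M. (cmod (w x))\<^sup>2 * (\<phi> x)\<^sup>2)"
proof -
  have "\<bar>Re z\<bar> \<le> 1 + (cmod z)\<^sup>2" for z
  proof -
    have "2 * \<bar>Re z\<bar> \<le> 1 + (cmod z)\<^sup>2"
      using two_Re_minus_one_le_norm_square[of z] two_Re_minus_one_le_norm_square[of "- z"]
      by (auto simp: abs_if)
    then show ?thesis
      by linarith
  qed
  then have "\<bar>(\<phi> x)\<^sup>2 * Re (w x)\<bar> \<le> (\<phi> x)\<^sup>2 + (cmod (w x))\<^sup>2 * (\<phi> x)\<^sup>2" for x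
    using mult_left_mono[of "\<bar>Re (w x)\<bar>" "1 + (cmod (w x))\<^sup>2" "(\<phi> x)\<^sup>2"]
    by (simp add: abs_mult algebra_simps)
  then have "integrable M (\<lambda>x. (\<phi> x)\<^sup>2 * Re (w x))"
    using Bochner_Integration.integrable_bound[OF Bochner_Integration.integrable_add[OF \<phi>(1) w],
      of "\<lambda>x. (\<phi> x)\<^sup>2 * Re (w x)"] meas
    by simp
  then have int: "integrable M (\<lambda>x. 2 * ((\<phi> x)\<^sup>2 * Re (w x)) - (\<phi> x)\<^sup>2)"
    using \<phi>(1) by simp
  have "2 * (LINT x|M. (\<phi> x)\<^sup>2 * Re (w x)) - 1 = (LINT x|M. 2 * ((\<phi> x)\<^sup>2 * Re (w x)) - (\<phi> x)\<^sup>2)"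
    using \<phi> \<open>integrable M (\<lambda>x. (\<phi> x)\<^sup>2 * Re (w x))\<close> by simp
  also have "\<dots> \<le> (LINT x|M. (cmod (w x))\<^sup>2 * (\<phi> x)\<^sup>2)"
  proof (rule integral_mono[OF int w])
    show "2 * ((\<phi> x)\<^sup>2 * Re (w x)) - (\<phi> x)\<^sup>2 \<le> (cmod (w x))\<^sup>2 * (\<phi> x)\<^sup>2" for x
      using mult_left_mono[OF two_Re_minus_one_le_norm_square[of "w x"], of "(\<phi> x)\<^sup>2"]
      by (simp add: algebra_simps)
  qed
  finally show ?thesis .
qed

theorem theorem8:
  fixes \<Omega> \<gamma>\<^sub>0 \<gamma>\<^sub>1 \<gamma>\<^sub>0' \<gamma>\<^sub>1' :: "complex set"
    and f F :: "complex \<Rightarrow> complex"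
    and a :: "nat \<Rightarrow> complex"
    and \<phi>\<^sub>1 :: "complex \<Rightarrow> real"
  defines "D \<equiv> ball (0::complex) 1"
  defines "V\<^sub>D \<equiv> pullback D f (V_space \<Omega> \<gamma>\<^sub>0)"
  assumes domain: "lipschitz_domain \<Omega>" "bounded \<Omega>" "simply_connected \<Omega>"
    and univalent: "f holomorphic_on D" "inj_on f D"
    and bilipschitz: "bilipschitz_homeomorphism D \<Omega> f"
    and power_series: "\<And>z. z \<in> D \<Longrightarrow> (\<lambda>n. a n * z ^ n) sums f z"
    and a1_real: "a 1 \<in> \<real>"
    and extension: "\<exists>G. homeomorphism (closure D) (closure \<Omega>) F G" "\<And>z. z \<in> D \<Longrightarrow> F z = f z"
    and boundary_parts: "openin (top_of_set (frontier \<Omega>)) \<gamma>\<^sub>0"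
      "openin (top_of_set (frontier \<Omega>)) \<gamma>\<^sub>1"
      "\<gamma>\<^sub>0 \<inter> \<gamma>\<^sub>1 = {}" "closure \<gamma>\<^sub>0 \<union> closure \<gamma>\<^sub>1 = frontier \<Omega>"
    and boundary_parts_D: "\<gamma>\<^sub>0' \<subseteq> frontier D" "\<gamma>\<^sub>1' \<subseteq> frontier D"
      "\<gamma>\<^sub>0 = F ` \<gamma>\<^sub>0'" "\<gamma>\<^sub>1 = F ` \<gamma>\<^sub>1'"
    and eigenfunction: "weak_eigenfunction D V\<^sub>D (first_eigenvalue D V\<^sub>D) \<phi>\<^sub>1"
  shows "first_eigenvalue D V\<^sub>D \<ge> first_eigenvalue \<Omega> (V_space \<Omega> \<gamma>\<^sub>0) *
     (2 * (LINT x|lebesgue_on D. (\<phi>\<^sub>1 x)\<^sup>2 * Re (deriv f x)) - 1)"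
proof -
  let ?V = "V_space \<Omega> \<gamma>\<^sub>0" and ?M = "lebesgue_on D"
  define \<mu>\<^sub>D where "\<mu>\<^sub>D = first_eigenvalue D V\<^sub>D"
  define \<mu>\<^sub>\<Omega> where "\<mu>\<^sub>\<Omega> = first_eigenvalue \<Omega> ?V"
  have "open D"
    by (simp add: D_def)
  have \<Omega>: "\<Omega> = f ` D"
    using bilipschitz by (auto simp: bilipschitz_homeomorphism_def homeomorphism_def)
  have "\<phi>\<^sub>1 \<in> V\<^sub>D" and "\<phi>\<^sub>1 \<in> H1 D" and norm1: "(LINT x|?M. (\<phi>\<^sub>1 x)\<^sup>2) = 1"
    using eigenfunction by (auto simp: weak_eigenfunction_def)
  then obtain v where v: "v \<in> ?V" "\<And>z. z \<in> D \<Longrightarrow> \<phi>\<^sub>1 z = v (f z)"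
    by (auto simp: V\<^sub>D_def pullback_def)
  obtain k where k: "has_weak_gradient (f ` D) v k"
    using v(1) by (auto simp: V_space_def H1_closure_def H1_def \<Omega>)
  obtain g where g: "has_weak_gradient D \<phi>\<^sub>1 g"
    using \<open>\<phi>\<^sub>1 \<in> H1 D\<close> by (auto simp: H1_def)
  have "L2_on D (\<lambda>z. v (f z))"
    using has_weak_gradient_cong[OF v(2) g] by (simp add: has_weak_gradient_def)
  note pull = weak_gradient_conformal_pullback[OF \<open>open D\<close> univalent k this]
  let ?h = "\<lambda>z. cnj (deriv f z) * k (f z)"
  have h: "has_weak_gradient D \<phi>\<^sub>1 ?h"
    by (rule has_weak_gradient_cong[OF _ pull(1)]) (simp add: v(2))
  \<comment> \<open>The eigenvalue equation, tested with \<open>\<phi>\<^sub>1\<close> itself and read with the weak gradient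
    that comes from \<open>v\<close>.\<close>
  have "(LINT z|?M. ?h z \<bullet> ?h z) = \<mu>\<^sub>D * (LINT z|?M. \<phi>\<^sub>1 z * \<phi>\<^sub>1 z)"
    using eigenfunction h \<open>\<phi>\<^sub>1 \<in> V\<^sub>D\<close> unfolding weak_eigenfunction_def \<mu>\<^sub>D_def by blast
  then have energy: "(LINT x|lebesgue_on \<Omega>. (norm (k x))\<^sup>2) = \<mu>\<^sub>D"
    using norm1 pull(2) by (simp add: \<Omega> power2_norm_eq_inner flip: power2_eq_square)

  \<comment> \<open>The mass of the trial function \<open>v\<close> on \<open>\<Omega>\<close>; it is positive because \<open>f'\<close> has no zeros.\<close>
  define m where "m = (LINT x|lebesgue_on \<Omega>. (v x)\<^sup>2)"
  have "has_bochner_integral ?M (\<lambda>z. (cmod (deriv f z))\<^sup>2 * (v (f z))\<^sup>2) m"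
    using k holomorphic_change_of_variables_real[OF \<open>open D\<close> univalent, of "\<lambda>x. (v x)\<^sup>2" m]
    by (simp add: has_bochner_integral_iff m_def \<Omega> has_weak_gradient_def L2_on_def)
  also have "?this \<longleftrightarrow> has_bochner_integral ?M (\<lambda>z. (cmod (deriv f z))\<^sup>2 * (\<phi>\<^sub>1 z)\<^sup>2) m"
    by (rule has_bochner_integral_cong) (simp_all add: v(2))
  finally have mass: "has_bochner_integral ?M (\<lambda>z. (cmod (deriv f z))\<^sup>2 * (\<phi>\<^sub>1 z)\<^sup>2) m" .
  have "m \<ge> 0"
    by (simp add: m_def)
  have "m \<noteq> 0"
  proof
    assume "m = 0"
    with mass have *: "AE z in ?M. (cmod (deriv f z))\<^sup>2 * (\<phi>\<^sub>1 z)\<^sup>2 = 0"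
      using integral_nonneg_eq_0_iff_AE[of ?M "\<lambda>z. (cmod (deriv f z))\<^sup>2 * (\<phi>\<^sub>1 z)\<^sup>2"]
      by (simp add: has_bochner_integral_iff)
    have nz: "deriv f z \<noteq> 0" if "z \<in> D" for z
      using holomorphic_injective_imp_regular[OF univalent(1) \<open>open D\<close> univalent(2) that] .
    have "AE z in ?M. (\<phi>\<^sub>1 z)\<^sup>2 = 0"
      by (rule lebesgue_on_mono[OF *]) (simp add: nz)
    then have "(LINT z|?M. (\<phi>\<^sub>1 z)\<^sup>2) = 0"
      by (rule integral_eq_zero_AE)
    with norm1 show False
      by simp
  qed
  with \<open>m \<ge> 0\<close> have "m > 0"
    by simp
  have quot: "\<mu>\<^sub>D / m \<in> rayleigh_quotients \<Omega> ?V"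
    unfolding rayleigh_quotients_def
    using v(1) k \<open>m \<noteq> 0\<close> energy
    by (intro CollectI exI[of _ v] exI[of _ k]) (simp add: m_def \<Omega>)
  from first_eigenvalue_le[OF this] have "\<mu>\<^sub>\<Omega> * m \<le> \<mu>\<^sub>D"
    using \<open>m > 0\<close> by (simp add: \<mu>\<^sub>\<Omega>_def pos_le_divide_eq)
  \<comment> \<open>The infimum of the empty set is unspecified, so nonnegativity needs the quotient just found.\<close>
  have "0 \<le> \<mu>\<^sub>\<Omega>"
    unfolding \<mu>\<^sub>\<Omega>_def first_eigenvalue_def
    using quot by (intro cInf_greatest) (auto intro: rayleigh_quotients_nonneg)
  have "2 * (LINT x|?M. (\<phi>\<^sub>1 x)\<^sup>2 * Re (deriv f x)) - 1 \<le> m"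
  proof -
    have "deriv f \<in> borel_measurable ?M"
      using holomorphic_deriv[OF univalent(1) \<open>open D\<close>] \<open>open D\<close>
      by (intro continuous_imp_measurable_on_sets_lebesgue holomorphic_on_imp_continuous_on) auto
    with g mass norm1 two_integral_Re_minus_one_le[of ?M \<phi>\<^sub>1 "deriv f"] show ?thesis
      by (simp add: has_weak_gradient_def L2_on_def has_bochner_integral_iff)
  qed
  with \<open>0 \<le> \<mu>\<^sub>\<Omega>\<close> have "\<mu>\<^sub>\<Omega> * (2 * (LINT x|?M. (\<phi>\<^sub>1 x)\<^sup>2 * Re (deriv f x)) - 1) \<le> \<mu>\<^sub>\<Omega> * m"
    by (rule mult_left_mono[rotated])
  also note \<open>\<mu>\<^sub>\<Omega> * m \<le> \<mu>\<^sub>D\<close>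
  finally show ?thesis
    by (simp add: \<mu>\<^sub>\<Omega>_def \<mu>\<^sub>D_def)
qed

end
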